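(* Let $n\ge 2$ be an integer. The sequence of poly-Bernoulli numbers $B_k^{(-(n-k))}$, $k=1,2,\dots,n-1$, is unimodal, and its maximum value is $B_{n_1}^{(-n_2)}$ where $n_1+n_2=n$ and $|n_1-n_2|\le 1$.
   Context: For an integer $k$ let $\mathrm{Li}_k(z)=\sum_{i=1}^\infty \frac{z^i}{i^k}$. The poly-Bernoulli numbers $B_n^{(k)}$ of order $k$ (for $n\ge 0$) are defined by $$\frac{\mathrm{Li}_k(1-\mathrm{e}^{-x})}{1-\mathrm{e}^{-x}}=\sum_{n=0}^\infty B_n^{(k)}\frac{x^n}{n!}.$$ A finite sequence $x_0,\dots,x_N$ is unimodal if there is some $0\le k\le N$ such that $x_0\le x_1\le\dots\le x_k\ge x_{k+1}\ge\dots\ge x_N$ (and similarly for a sequence indexed by another finite interval of integers). *)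

theory Defs
  imports "HOL-Computational_Algebra.Formal_Power_Series"
begin

text \<open>The polylogarithm \<open>Li\<^sub>k\<close> as a formal power series. Its constant coefficient is set to 0
  explicitly because \<open>0 powi 0 = 1\<close>.\<close>

definition polylog_fps :: "int \<Rightarrow> real fps" where
  "polylog_fps k = Abs_fps (\<lambda>i. if i = 0 then 0 else 1 / (of_nat i powi k))"

text \<open>\<open>poly_bernoulli n k\<close> is the number \<open>B\<^sub>n\<close> of order \<open>k\<close>. The inner series \<open>1 - exp (-x)\<close>
  has constant term 0, so the composition is meaningful; it has subdegree 1, so it is not
  invertible, but it divides the composition exactly (lemma \<open>poly_bernoulli_gf\<close>).\<close>

definition poly_bernoulli :: "nat \<Rightarrow> int \<Rightarrow> real" where
  "poly_bernoulli n k =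
     fact n * fps_nth ((polylog_fps k oo (1 - fps_exp (-1))) / (1 - fps_exp (-1))) n"

lemma poly_bernoulli_egf:
  "(polylog_fps k oo (1 - fps_exp (-1))) / (1 - fps_exp (-1)) =
     Abs_fps (\<lambda>n. poly_bernoulli n k / fact n)"
  by (simp add: poly_bernoulli_def fps_eq_iff)

lemma poly_bernoulli_gf:
  "polylog_fps k oo (1 - fps_exp (-1)) =
     Abs_fps (\<lambda>n. poly_bernoulli n k / fact n) * (1 - fps_exp (-1))"
proof -
  let ?h = "1 - fps_exp (-1) :: real fps"
  define g where "g = Abs_fps (\<lambda>i. 1 / (of_nat (Suc i) powi k) :: real)"
  have "polylog_fps k = g * fps_X"
    by (rule fps_ext) (auto simp: polylog_fps_def g_def)
  hence "polylog_fps k oo ?h = (g oo ?h) * ?h"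
    by (simp add: fps_compose_mult_distrib)
  hence "?h dvd (polylog_fps k oo ?h)"
    by simp
  thus ?thesis
    unfolding poly_bernoulli_egf[symmetric] by simp
qed

text \<open>Unimodality of the finite sequence \<open>x\<^sub>a, \<dots>, x\<^sub>b\<close>; in particular the sequence is nonempty.\<close>

definition unimodal :: "nat \<Rightarrow> nat \<Rightarrow> (nat \<Rightarrow> 'a :: linorder) \<Rightarrow> bool" where
  "unimodal a b x \<longleftrightarrow>
     (\<exists>m\<in>{a..b}. (\<forall>i. a \<le> i \<and> i < m \<longrightarrow> x i \<le> x (Suc i)) \<and>
                 (\<forall>i. m \<le> i \<and> i < b \<longrightarrow> x i \<ge> x (Suc i)))"

end

theory Submission
  imports Defs "HOL-Combinatorics.Stirling"
begin

text \<open>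
  Put \<open>w n j = j! S(n+1, j+1)\<close> with \<open>S\<close> the Stirling numbers of the second kind, and write
  \<open>B(n, k)\<close> for the poly-Bernoulli number of index \<open>n\<close> and order \<open>-k\<close>.  These numbers are the
  entries of a Gram matrix, \<open>B(n, k) = (\<Sum>j. w n j * w k j)\<close> (lemma
  \<open>poly_bernoulli_neg_eq_sum\<close>).
  The reason is that \<open>w\<close> answers two questions at once: \<open>w k j\<close> are the coefficients of
  \<open>(i+1)^k\<close> in the basis of binomial coefficients \<open>i choose j\<close>, and \<open>w n j / n!\<close> are the
  coefficients of the series \<open>exp x * (exp x - 1)^j\<close>, which is what \<open>\<Sum>i. (i choose j) z^i\<close>
  becomes under \<open>z = 1 - exp (-x)\<close>.

  The recurrence \<open>w (n+1) j = (j+1) w n j + j w n (j-1)\<close> then gives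
  \<open>B(n+1, k) - B(n, k+1) = (\<Sum>j. j * (w n (j-1) * w k j - w n j * w k (j-1)))\<close>,
  because the diagonal terms cancel.  Each bracket is a minor of order two of the matrix \<open>w\<close>, and
  these minors are nonnegative for \<open>n \<le> k\<close> (lemma \<open>weight_TP2\<close>).  Hence moving one
  unit from the larger to the smaller of the two indices does not decrease the value; since the
  Gram form is also symmetric in the two indices, the antidiagonal increases up to its middle and
  decreases after it.
\<close>

section \<open>Weighted Stirling numbers\<close>

definition weight :: "nat \<Rightarrow> nat \<Rightarrow> nat" where
  "weight n j = fact j * Stirling (Suc n) (Suc j)"

lemma weight_0: "weight 0 j = (if j = 0 then 1 else 0)"
  by (cases j) (simp_all add: weight_def)

text \<open>For \<open>j = 0\<close> the truncated index \<open>j - 1\<close> is harmless, since its coefficient vanishes.\<close>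

lemma weight_Suc: "weight (Suc n) j = Suc j * weight n j + j * weight n (j - 1)"
  by (cases j) (simp_all add: weight_def algebra_simps)

lemma weight_eq_0: "n < j \<Longrightarrow> weight n j = 0"
  by (simp add: weight_def)

text \<open>
  Row \<open>n + 1\<close> arises from row \<open>n\<close> by a bidiagonal matrix with nonnegative entries.  By
  Cauchy--Binet, a minor on rows \<open>n + 1, k + 1\<close> is therefore a nonnegative combination of the four
  minors on rows \<open>n, k\<close> whose columns are \<open>i\<close> or \<open>i - 1\<close> and \<open>j\<close> or \<open>j - 1\<close>.  This reduces the
  claim to \<open>n = 0\<close>, where the row is a unit vector.
\<close>

lemma weight_TP2:
  assumes "n \<le> k" "i \<le> j"
  shows "weight n j * weight k i \<le> weight n i * weight k j"
  using assms
proof (induction n arbitrary: k i j)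
  case 0
  then show ?case by (auto simp: weight_0)
next
  case (Suc n)
  show ?case
  proof (cases "i = j")
    case False
    with Suc.prems have "i < j" by simp
    from Suc.prems obtain l where k: "k = Suc l" and "n \<le> l" by (cases k) auto
    let ?D = "\<lambda>a b. weight n b * weight l a"
    let ?E = "\<lambda>a b. weight n a * weight l b"
    have minor: "?D a b \<le> ?E a b" if "a \<le> b" for a b
      using Suc.IH[OF \<open>n \<le> l\<close> that] .
    have "weight (Suc n) j * weight k i =
        Suc i * Suc j * ?D i j + Suc i * j * ?D i (j - 1) + i * Suc j * ?D (i - 1) j
        + i * j * ?D (i - 1) (j - 1)"
      unfolding k weight_Suc by (simp only: algebra_simps)
    also have "\<dots> \<le> Suc i * Suc j * ?E i j + Suc i * j * ?E i (j - 1) + i * Suc j * ?E (i - 1) j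
        + i * j * ?E (i - 1) (j - 1)"
      using \<open>i < j\<close> by (intro add_mono mult_left_mono minor) auto
    also have "\<dots> = weight (Suc n) i * weight k j"
      unfolding k weight_Suc by (simp only: algebra_simps)
    finally show ?thesis .
  qed simp
qed

section \<open>Poly-Bernoulli numbers of negative order as a Gram matrix\<close>

lemma power_eq_sum_weight_binomial:
  assumes "k \<le> N"
  shows "Suc i ^ k = (\<Sum>j\<le>N. weight k j * (i choose j))"
  using assms
proof (induction k)
  case 0
  then show ?case by (simp add: weight_0 if_distrib[of "\<lambda>x. x * _"] cong: if_cong)
next
  case (Suc k)
  have absorb: "Suc i * (i choose j) = Suc j * (i choose j) + Suc j * (i choose Suc j)" for j
    using Suc_times_binomial_eq[of i j] by (simp add: algebra_simps)
  have "Suc i ^ Suc k = (\<Sum>j\<le>N. weight k j * (Suc i * (i choose j)))"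
    using Suc by (simp add: sum_distrib_left algebra_simps del: mult_Suc mult_Suc_right)
  also have "\<dots> = (\<Sum>j\<le>N. Suc j * weight k j * (i choose j))
      + (\<Sum>j\<le>N. Suc j * weight k j * (i choose Suc j))"
    unfolding absorb by (simp add: sum.distrib[symmetric] algebra_simps)
  \<comment> \<open>The top term has weight 0, because \<open>k < N\<close>, so the index of the second sum can be shifted.\<close>
  also have "(\<Sum>j\<le>N. Suc j * weight k j * (i choose Suc j)) =
      (\<Sum>j\<le>N. j * weight k (j - 1) * (i choose j))"
  proof -
    have "(\<Sum>j\<le>N. j * weight k (j - 1) * (i choose j)) =
        (\<Sum>j\<le>Suc N. j * weight k (j - 1) * (i choose j))"
      using Suc.prems by (simp add: weight_eq_0)
    also have "\<dots> = (\<Sum>j\<le>N. Suc j * weight k j * (i choose Suc j))"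
      by (subst sum.atMost_Suc_shift) simp
    finally show ?thesis by simp
  qed
  finally show ?case
    by (simp add: weight_Suc sum.distrib[symmetric] algebra_simps)
qed

lemma fps_nth_exp_power_eq_weight:
  "fact n * fps_nth (fps_exp (1::real) * (fps_exp 1 - 1) ^ j) n = real (weight n j)"
proof (induction n arbitrary: j)
  case 0
  then show ?case by (simp add: weight_0 fps_mult_nth_0 fps_nth_power_0)
next
  case (Suc n)
  define G where "G = (\<lambda>j. fps_exp (1::real) * (fps_exp 1 - 1) ^ j)"
  \<comment> \<open>Differentiation reproduces the recurrence of the weights.\<close>
  have deriv: "fps_deriv (G j) = of_nat (Suc j) * G j + of_nat j * G (j - 1)"
  proof (cases j)
    case (Suc i)
    have "fps_deriv ((fps_exp (1::real) - 1) ^ Suc i) =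
        of_nat (Suc i) * (fps_exp 1 - 1) ^ i * fps_exp 1"
      by (simp add: fps_deriv_power' fps_of_nat del: power_Suc)
    then have "fps_deriv (G j) = fps_exp 1 * (fps_exp 1 - 1) ^ Suc i
        + fps_exp 1 * (of_nat (Suc i) * (fps_exp 1 - 1) ^ i * fps_exp 1)"
      by (simp add: G_def Suc del: power_Suc of_nat_Suc)
    then show ?thesis by (simp add: G_def Suc algebra_simps)
  qed (simp add: G_def)
  have "fact (Suc n) * fps_nth (G j) (Suc n) = fact n * fps_nth (fps_deriv (G j)) n"
    by (simp add: algebra_simps)
  also have "\<dots> = of_nat (Suc j) * (fact n * fps_nth (G j) n)
      + of_nat j * (fact n * fps_nth (G (j - 1)) n)"
    unfolding deriv by (simp add: fps_mult_of_nat_nth algebra_simps)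
  also have "\<dots> = real (weight (Suc n) j)"
    unfolding G_def Suc.IH weight_Suc by (simp add: algebra_simps)
  finally show ?case unfolding G_def .
qed

text \<open>
  The composed series is \<open>z^j / (1 - z)^(j+1)\<close>.  The substitution turns \<open>1 - z\<close> into
  \<open>exp (-x)\<close> and hence \<open>z / (1 - z)\<close> into \<open>exp x - 1\<close>.
\<close>

lemma binomial_series_compose:
  "Abs_fps (\<lambda>i. real (i choose j)) oo (1 - fps_exp (-1)) = fps_exp 1 * (fps_exp 1 - 1) ^ j"
proof -
  define P where "P = (\<lambda>j. Abs_fps (\<lambda>i. real (i choose j)))"
  define h where "h = (1 - fps_exp (-1) :: real fps)"
  have h0: "fps_nth h 0 = 0" by (simp add: h_def)
  have inv: "fps_exp (-1) * fps_exp (1::real) = 1"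
    by (simp add: fps_exp_add_mult[symmetric])
  have comp: "(1 - fps_X) oo h = fps_exp (-1)"
    using h0 by (simp add: fps_compose_sub_distrib h_def)
  have cancel: "p oo h = (q oo h) * fps_exp 1" if "p * (1 - fps_X) = q" for p q
  proof -
    have "(p oo h) * fps_exp (-1) = q oo h"
      using that by (metis comp fps_compose_mult_distrib h0)
    then show ?thesis by (metis inv mult.assoc mult.right_neutral)
  qed
  have "P j oo h = fps_exp 1 * (fps_exp 1 - 1) ^ j"
  proof (induction j)
    case 0
    have "P 0 * (1 - fps_X) = 1"
      by (rule fps_ext) (simp add: P_def right_diff_distrib)
    from cancel[OF this] show ?case by simp
  next
    case (Suc j)
    have "P (Suc j) * (1 - fps_X) = fps_X * P j"
    proof (rule fps_ext)
      fix i show "fps_nth (P (Suc j) * (1 - fps_X)) i = fps_nth (fps_X * P j) i"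
        by (cases i) (simp_all add: P_def right_diff_distrib)
    qed
    from cancel[OF this] have "P (Suc j) oo h = h * (P j oo h) * fps_exp 1"
      using h0 by (simp add: fps_compose_mult_distrib)
    also have "\<dots> = (h * fps_exp 1) * (P j oo h)"
      by (simp add: ac_simps)
    also have "h * fps_exp 1 = fps_exp 1 - 1"
      using inv by (simp add: h_def left_diff_distrib)
    finally show ?case by (simp add: Suc.IH ac_simps)
  qed
  then show ?thesis by (simp add: P_def h_def)
qed

text \<open>
  The bound \<open>N\<close> is arbitrary above \<open>k\<close>, so that one range of summation serves all entries of an
  antidiagonal.
\<close>

lemma poly_bernoulli_neg_eq_sum:
  assumes "k \<le> N"
  shows "poly_bernoulli n (- int k) = real (\<Sum>j\<le>N. weight n j * weight k j)"
proof -
  define h where "h = (1 - fps_exp (-1) :: real fps)"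
  define g where "g = Abs_fps (\<lambda>i. real (Suc i ^ k))"
  have h0: "fps_nth h 0 = 0" by (simp add: h_def)
  have "fps_nth h 1 \<noteq> 0" by (simp add: h_def)
  then have "h \<noteq> 0" by auto
  have "polylog_fps (- int k) = g * fps_X"
  proof (rule fps_ext)
    fix i show "fps_nth (polylog_fps (- int k)) i = fps_nth (g * fps_X) i"
      by (cases i) (simp_all add: polylog_fps_def g_def power_int_minus divide_inverse)
  qed
  then have "(polylog_fps (- int k) oo h) / h = g oo h"
    using \<open>h \<noteq> 0\<close> h0 by (simp add: fps_compose_mult_distrib)
  also have "g = (\<Sum>j\<le>N. fps_const (real (weight k j)) * Abs_fps (\<lambda>i. real (i choose j)))"
    by (rule fps_ext)
      (simp add: g_def fps_sum_nth power_eq_sum_weight_binomial[OF assms] del: of_nat_power power_Suc)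
  also have "\<dots> oo h =
      (\<Sum>j\<le>N. fps_const (real (weight k j)) * (fps_exp 1 * (fps_exp 1 - 1) ^ j))"
    using h0 by (simp add: fps_compose_sum_distrib fps_compose_mult_distrib
        binomial_series_compose[folded h_def])
  finally have "poly_bernoulli n (- int k) = fact n * fps_nth
      (\<Sum>j\<le>N. fps_const (real (weight k j)) * (fps_exp 1 * (fps_exp 1 - 1) ^ j)) n"
    by (simp only: poly_bernoulli_def h_def)
  also have "\<dots> =
      (\<Sum>j\<le>N. real (weight k j) * (fact n * fps_nth (fps_exp 1 * (fps_exp 1 - 1) ^ j) n))"
    by (simp only: fps_sum_nth sum_distrib_left fps_mult_left_const_nth
        mult.left_commute[of "fact n" "real _"])
  finally have "poly_bernoulli n (- int k) = \<dots>" .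
  then show ?thesis
    by (simp add: fps_nth_exp_power_eq_weight mult.commute)
qed

section \<open>The shape of an antidiagonal\<close>

lemma poly_bernoulli_neg_symmetric: "poly_bernoulli n (- int k) = poly_bernoulli k (- int n)"
  using poly_bernoulli_neg_eq_sum[of k "n + k" n] poly_bernoulli_neg_eq_sum[of n "n + k" k]
  by (simp add: mult.commute)

text \<open>
  Expanding one factor on each side by the recurrence of the weights leaves the same diagonal terms
  on both sides; the remaining terms are compared by the minors on adjacent columns.
\<close>

lemma poly_bernoulli_neg_balance_mono:
  assumes "n \<le> k"
  shows "poly_bernoulli n (- int (Suc k)) \<le> poly_bernoulli (Suc n) (- int k)"
proof -
  have "weight n j * weight (Suc k) j \<le> weight (Suc n) j * weight k j" for j
  proof -
    have "weight n j * weight (Suc k) j =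
        Suc j * weight n j * weight k j + j * (weight n j * weight k (j - 1))"
      unfolding weight_Suc by (simp only: algebra_simps)
    also have "\<dots> \<le> Suc j * weight n j * weight k j + j * (weight n (j - 1) * weight k j)"
      by (intro add_left_mono mult_left_mono weight_TP2 assms) auto
    also have "\<dots> = weight (Suc n) j * weight k j"
      unfolding weight_Suc by (simp only: algebra_simps)
    finally show ?thesis .
  qed
  then have "(\<Sum>j\<le>Suc k. weight n j * weight (Suc k) j) \<le> (\<Sum>j\<le>Suc k. weight (Suc n) j * weight k j)"
    by (intro sum_mono)
  then show ?thesis
    using poly_bernoulli_neg_eq_sum[of "Suc k" "Suc k" n]
      poly_bernoulli_neg_eq_sum[of k "Suc k" "Suc n"] by (simp only: of_nat_le_iff le_SucI order_refl)
qed

theorem corollary3p7: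
  fixes n :: nat
  assumes "n \<ge> 2"
  shows "unimodal 1 (n - 1) (\<lambda>k. poly_bernoulli k (- (int n - int k))) \<and>
    (\<forall>n1 n2 :: nat. n1 + n2 = n \<and> \<bar>int n1 - int n2\<bar> \<le> 1 \<longrightarrow>
       poly_bernoulli n1 (- int n2) =
         Max ((\<lambda>k. poly_bernoulli k (- (int n - int k))) ` {1..n - 1}))"
proof -
  define x where "x = (\<lambda>k. poly_bernoulli k (- (int n - int k)))"
  define m where "m = n div 2"
  have m: "m \<in> {1..n - 1}" using assms by (auto simp: m_def)
  have x_eq: "x k = poly_bernoulli k (- int (n - k))" if "k \<le> n" for k
    using that by (simp add: x_def of_nat_diff)
  have x_sym: "x (n - k) = x k" if "k \<le> n" for k
    using that poly_bernoulli_neg_symmetric[of k "n - k"] by (simp add: x_eq del: of_nat_diff)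
  have step: "x i \<le> x (Suc i)" if "Suc (2 * i) \<le> n" for i
  proof -
    from that have "i \<le> n - Suc i" "Suc (n - Suc i) = n - i" "i \<le> n" "Suc i \<le> n" by auto
    with poly_bernoulli_neg_balance_mono[of i "n - Suc i"] show ?thesis
      by (simp add: x_eq del: of_nat_diff)
  qed
  have up: "x i \<le> x (Suc i)" if "i < m" for i
    using that by (intro step) (auto simp: m_def)
  \<comment> \<open>Symmetry reflects the comparisons below the middle to those above it.\<close>
  have down: "x (Suc i) \<le> x i" if "m \<le> i" "i < n" for i
  proof -
    from that have "Suc (2 * (n - Suc i)) \<le> n" and "Suc (n - Suc i) = n - i"
      by (auto simp: m_def)
    then show ?thesis
      using step[of "n - Suc i"] x_sym[of i] x_sym[of "Suc i"] \<open>i < n\<close> by simp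
  qed
  have unimodal: "unimodal 1 (n - 1) x"
    unfolding unimodal_def using m up down by (intro bexI[of _ m]) auto
  have le_mode: "x i \<le> x m" if "i \<le> n" for i
  proof (cases "i \<le> m")
    case True
    then show ?thesis
      by (induction rule: inc_induct) (auto intro: order_trans up)
  next
    case False
    then have "m \<le> i" by simp
    then show ?thesis using \<open>i \<le> n\<close>
      by (induction rule: dec_induct) (auto intro: order_trans[OF down])
  qed
  have "Max (x ` {1..n - 1}) = x m"
    using m le_mode by (intro Max_eqI) auto
  moreover have "poly_bernoulli n1 (- int n2) = x m"
    if "n1 + n2 = n" "\<bar>int n1 - int n2\<bar> \<le> 1" for n1 n2
  proof -
    have "n1 = m \<and> n2 = n - m \<or> n1 = n - m \<and> n2 = m"
      using that by (auto simp: m_def)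
    then show ?thesis
      using x_eq[of m] x_eq[of "n - m"] x_sym[of m] by (auto simp: m_def)
  qed
  ultimately show ?thesis using unimodal unfolding x_def by simp
qed

end
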